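(* Assume that the entropy variables are not constant in $K$, i.e. the vectors $w_\sigma\in\mathbb{R}^m$, $\sigma\in K$, are not all equal. Define $$r_\sigma^K=\alpha\,(w_\sigma-\overline{w}),\quad \sigma\in K,\qquad \overline{w}=\frac{1}{\#K}\sum_{\sigma\in K}w_\sigma,\qquad \alpha=\frac{\mathcal{E}}{\sum_{\sigma\in K}\|w_\sigma-\overline{w}\|^2}.$$ Then $r=(r_\sigma^K)_{\sigma\in K}$ is the unique solution of the minimization problem $$\min_{r\in(\mathbb{R}^m)^{K}}\ \frac12\sum_{\sigma\in K}\|r_\sigma^K\|^2\quad\text{subject to}\quad\sum_{\sigma\in K}r_\sigma^K=0,\qquad\sum_{\sigma\in K}\langle w_\sigma,r_\sigma^K\rangle=\mathcal{E}.$$ That is, $r$ is the unique optimal correction of the residuals $\tilde\Phi_\sigma^K=\Phi_\sigma^K+r_\sigma^K$, measured in the discrete norm induced by the identity matrix, such that $\sum_{\sigma\in K}r_\sigma^K=0$ and $$\sum_{\sigma\in K}\langle w_\sigma,\tilde\Phi_\sigma^K\rangle=\oint_{\partial K}\sum_j F^{\mathrm{num},j}\bigl(w^h_{|K},w^h_{|K^-}\bigr)\,\nu_j .$$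
   Context: Consider a residual distribution scheme for a system of $m$ conservation laws. $K$ is an element of the mesh, identified where convenient with its finite set of degrees of freedom $\sigma\in K$, and $\#K$ is the number of these. For each $\sigma\in K$, $\Phi_\sigma^K\in\mathbb{R}^m$ is the given sub-residual and $w_\sigma\in\mathbb{R}^m$ is the value of the entropy variable at $\sigma$. $\langle\cdot,\cdot\rangle$ and $\|\cdot\|$ are the Euclidean inner product and norm on $\mathbb{R}^m$. $\oint$ denotes the discrete evaluation of an integral by a quadrature rule, $\nu_j$ is the $j$-th component of the outer unit normal at $\partial K$, $F^{\mathrm{num},j}$ is a real-valued numerical entropy flux in direction $j$, $w^h_{|K}$ is the restriction to $K$ of the numerical approximation of the entropy variables, and $w^h_{|K^-}$ is its restriction on the other side of the local edge/face of $K$. The real number $\mathcal{E}$ is $$\mathcal{E}=\oint_{\partial K}\sum_j F^{\mathrm{num},j}\bigl(w^h_{|K},w^h_{|K^-}\bigr)\,\nu_j-\sum_{\sigma\in K}\langle w_\sigma,\Phi_\sigma^K\rangle.$$ *)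

theory Defs
  imports "HOL-Analysis.Analysis" "HOL-Library.FuncSet"
begin

text \<open>
  The discrete boundary integral of the numerical entropy flux over an element of a mesh in
  \<open>\<real>\<^sup>d\<close>. The boundary is split into local edges/faces \<open>e \<in> faces\<close>, and on each of them the
  quadrature rule has the nodes \<open>x \<in> nodes e\<close> with weights \<open>\<omega> e x\<close>. The approximation
  across a face depends on that face, hence \<open>wm e\<close> for the trace from the other side of \<open>e\<close>;
  likewise \<open>\<nu> e x\<close> is the normal belonging to \<open>e\<close>, since a node may lie on several faces.
  No relation between the geometry and \<open>nodes\<close>, \<open>\<omega>\<close>, \<open>\<nu>\<close> is imposed: they are arbitrary
  data, which includes outer unit normals and quadrature rules of any kind.
\<close>

definition boundary_flux ::
  "'e set \<Rightarrow> ('e \<Rightarrow> (real^'d) set) \<Rightarrow> ('e \<Rightarrow> real^'d \<Rightarrow> real) \<Rightarrow> ('e \<Rightarrow> real^'d \<Rightarrow> real^'d)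
    \<Rightarrow> ('d \<Rightarrow> real^'m \<Rightarrow> real^'m \<Rightarrow> real) \<Rightarrow> (real^'d \<Rightarrow> real^'m) \<Rightarrow> ('e \<Rightarrow> real^'d \<Rightarrow> real^'m) \<Rightarrow> real"
  where "boundary_flux faces nodes \<omega> \<nu> F wh wm =
    (\<Sum>e\<in>faces. \<Sum>x\<in>nodes e. \<omega> e x * (\<Sum>j\<in>UNIV. F j (wh x) (wm e x) * \<nu> e x $ j))"

text \<open>The entropy error, with \<open>b\<close> the discrete boundary integral of the entropy flux.\<close>

definition entropy_error ::
  "real \<Rightarrow> 's set \<Rightarrow> ('s \<Rightarrow> real^'m) \<Rightarrow> ('s \<Rightarrow> real^'m) \<Rightarrow> real"
  where "entropy_error b K w \<Phi> = b - (\<Sum>\<sigma>\<in>K. w \<sigma> \<bullet> \<Phi> \<sigma>)"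

definition mean_value :: "'s set \<Rightarrow> ('s \<Rightarrow> real^'m) \<Rightarrow> real^'m"
  where "mean_value K w = (1 / real (card K)) *\<^sub>R (\<Sum>\<sigma>\<in>K. w \<sigma>)"

definition correction_factor :: "real \<Rightarrow> 's set \<Rightarrow> ('s \<Rightarrow> real^'m) \<Rightarrow> real"
  where "correction_factor E K w = E / (\<Sum>\<sigma>\<in>K. (norm (w \<sigma> - mean_value K w))\<^sup>2)"

text \<open>
  Families \<open>(r\<^sub>\<sigma>)\<close> indexed by \<open>\<sigma> \<in> K\<close> are elements of \<open>K \<rightarrow>\<^sub>E UNIV\<close>, i.e. functions that are
  \<open>undefined\<close> outside \<open>K\<close>, so that equality of families is equality of functions.
\<close>

definition correction :: "real \<Rightarrow> 's set \<Rightarrow> ('s \<Rightarrow> real^'m) \<Rightarrow> 's \<Rightarrow> real^'m"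
  where "correction E K w = (\<lambda>\<sigma>\<in>K. correction_factor E K w *\<^sub>R (w \<sigma> - mean_value K w))"

text \<open>
  The discrete norm on \<open>(\<real>\<^sup>m)\<^sup>K\<close> induced by a (symmetric positive definite) matrix \<open>M\<close> indexed
  by the degrees of freedom, as for a mass matrix.
\<close>

definition discrete_norm :: "'s set \<Rightarrow> ('s \<Rightarrow> 's \<Rightarrow> real) \<Rightarrow> ('s \<Rightarrow> real^'m) \<Rightarrow> real"
  where "discrete_norm K M r = sqrt (\<Sum>\<sigma>\<in>K. \<Sum>\<tau>\<in>K. M \<sigma> \<tau> * (r \<sigma> \<bullet> r \<tau>))"

definition identity_matrix :: "'s \<Rightarrow> 's \<Rightarrow> real"
  where "identity_matrix \<sigma> \<tau> = (if \<sigma> = \<tau> then 1 else 0)"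

end

theory Submission
  imports Defs
begin

text \<open>
  Every feasible family \<open>r\<close> satisfies \<open>\<Sum>\<sigma>\<in>K. r \<sigma> \<bullet> (w \<sigma> - w\<^sub>0) = E\<close>, where \<open>w\<^sub>0\<close> is the mean
  value. The correction \<open>c\<close> is feasible and a multiple of \<open>w - w\<^sub>0\<close>, so all feasible families have
  the same inner product with \<open>c\<close>. By Pythagoras, \<open>\<parallel>r\<parallel>\<^sup>2 = \<parallel>c\<parallel>\<^sup>2 + \<parallel>r - c\<parallel>\<^sup>2\<close>.
\<close>

text \<open>A strict inequality against every other feasible point yields minimality and uniqueness
  together, so one estimate settles each problem.\<close>

lemma is_arg_min_unique:
  fixes f :: "'a \<Rightarrow> 'b::linorder"
  assumes "P c" "\<And>x. P x \<Longrightarrow> x \<noteq> c \<Longrightarrow> f c < f x"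
  shows "{x. is_arg_min f P x} = {c}"
  using assms unfolding is_arg_min_def by (auto dest: order.asym)

lemma sum_diff_mean_value:
  assumes "finite K" "K \<noteq> {}"
  shows "(\<Sum>\<sigma>\<in>K. w \<sigma> - mean_value K w) = 0"
  using assms by (simp add: sum_subtractf mean_value_def sum_constant_scaleR del: sum_constant)

text \<open>The shift by \<open>a\<close> contributes
  \<open>a \<bullet> (\<Sum>\<sigma>\<in>K. r \<sigma>)\<close>, which vanishes.\<close>

lemma sum_inner_diff_const:
  fixes w r :: "'s \<Rightarrow> 'a::real_inner"
  assumes "(\<Sum>\<sigma>\<in>K. r \<sigma>) = 0"
  shows "(\<Sum>\<sigma>\<in>K. (w \<sigma> - a) \<bullet> r \<sigma>) = (\<Sum>\<sigma>\<in>K. w \<sigma> \<bullet> r \<sigma>)"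
  using assms by (simp add: inner_diff_left sum_subtractf flip: inner_sum_right)

text \<open>If every \<open>w \<sigma>\<close> equalled the mean value, no two of them could differ.
  Positivity keeps the denominator of \<open>correction_factor\<close> away from 0.\<close>

lemma sum_norm_diff_mean_value_pos:
  assumes "finite K" "\<exists>\<sigma>\<in>K. \<exists>\<tau>\<in>K. w \<sigma> \<noteq> w \<tau>"
  shows "(\<Sum>\<sigma>\<in>K. (norm (w \<sigma> - mean_value K w))\<^sup>2) > 0"
proof -
  obtain \<sigma> where "\<sigma> \<in> K" "w \<sigma> \<noteq> mean_value K w"
    using assms(2) by metis
  with assms(1) show ?thesis
    by (intro sum_pos2[where i = \<sigma>]) auto
qed

lemma sum_correction:
  assumes "finite K" "K \<noteq> {}"
  shows "(\<Sum>\<sigma>\<in>K. correction E K w \<sigma>) = 0"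
  using sum_diff_mean_value[OF assms, of w]
  by (simp add: correction_def flip: scaleR_sum_right)

lemma sum_inner_correction:
  assumes "finite K" "\<exists>\<sigma>\<in>K. \<exists>\<tau>\<in>K. w \<sigma> \<noteq> w \<tau>"
  shows "(\<Sum>\<sigma>\<in>K. w \<sigma> \<bullet> correction E K w \<sigma>) = E"
proof -
  have "(\<Sum>\<sigma>\<in>K. w \<sigma> \<bullet> correction E K w \<sigma>)
      = (\<Sum>\<sigma>\<in>K. (w \<sigma> - mean_value K w) \<bullet> correction E K w \<sigma>)"
    by (rule sum_inner_diff_const[symmetric]) (use assms sum_correction in blast)
  also have "\<dots> = correction_factor E K w * (\<Sum>\<sigma>\<in>K. (norm (w \<sigma> - mean_value K w))\<^sup>2)"
    by (simp add: correction_def sum_distrib_left power2_norm_eq_inner)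
  also have "\<dots> = E"
    using sum_norm_diff_mean_value_pos[OF assms] by (simp add: correction_factor_def)
  finally show ?thesis .
qed

lemma sum_correction_inner:
  assumes "(\<Sum>\<sigma>\<in>K. r \<sigma>) = 0"
  shows "(\<Sum>\<sigma>\<in>K. correction E K w \<sigma> \<bullet> r \<sigma>) = correction_factor E K w * (\<Sum>\<sigma>\<in>K. w \<sigma> \<bullet> r \<sigma>)"
  using sum_inner_diff_const[OF assms, of w "mean_value K w"]
  by (simp add: correction_def flip: sum_distrib_left)

lemma norm_correction_less:
  assumes K: "finite K" "\<exists>\<sigma>\<in>K. \<exists>\<tau>\<in>K. w \<sigma> \<noteq> w \<tau>"
    and r: "r \<in> K \<rightarrow>\<^sub>E UNIV" "(\<Sum>\<sigma>\<in>K. r \<sigma>) = 0" "(\<Sum>\<sigma>\<in>K. w \<sigma> \<bullet> r \<sigma>) = E"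
    and "r \<noteq> correction E K w"
  shows "(\<Sum>\<sigma>\<in>K. (norm (correction E K w \<sigma>))\<^sup>2) < (\<Sum>\<sigma>\<in>K. (norm (r \<sigma>))\<^sup>2)"
proof -
  define c where "c = correction E K w"
  have "K \<noteq> {}" using K by auto
  have "(\<Sum>\<sigma>\<in>K. c \<sigma> \<bullet> r \<sigma>) = correction_factor E K w * E"
    using sum_correction_inner[OF r(2)] r(3) by (simp add: c_def)
  \<comment> \<open>The correction is feasible itself, so the formula for \<open>r\<close> also
    applies to \<open>c\<close>.\<close>
  moreover have "(\<Sum>\<sigma>\<in>K. c \<sigma> \<bullet> c \<sigma>) = correction_factor E K w * E"
    unfolding c_def
    by (simp add: sum_correction_inner sum_correction sum_inner_correction K \<open>K \<noteq> {}\<close>)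
  \<comment> \<open>Equality of the two inner products makes \<open>r - c\<close> orthogonal to
    \<open>c\<close>.\<close>
  ultimately have "(\<Sum>\<sigma>\<in>K. (norm (r \<sigma>))\<^sup>2)
      = (\<Sum>\<sigma>\<in>K. (norm (c \<sigma>))\<^sup>2) + (\<Sum>\<sigma>\<in>K. (norm (r \<sigma> - c \<sigma>))\<^sup>2)"
    by (simp add: power2_norm_eq_inner inner_diff_left inner_diff_right inner_commute
        sum_subtractf sum.distrib flip: sum_distrib_left)
  \<comment> \<open>Both families are \<open>undefined\<close> outside \<open>K\<close>, so they
    must differ at some index in \<open>K\<close>.\<close>
  moreover obtain \<sigma> where "\<sigma> \<in> K" "r \<sigma> \<noteq> c \<sigma>"
    using PiE_ext[OF r(1), of c] assms(6)
    by (auto simp: c_def correction_def)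
  then have "(\<Sum>\<sigma>\<in>K. (norm (r \<sigma> - c \<sigma>))\<^sup>2) > 0"
    using K(1) by (intro sum_pos2[where i = \<sigma>]) auto
  ultimately show ?thesis
    by (simp add: c_def)
qed

text \<open>Only the diagonal of the double sum survives. Since \<open>sqrt\<close> is strictly
  increasing, the strict inequality between sums of squares carries over to this norm.\<close>

lemma discrete_norm_identity_matrix:
  assumes "finite K"
  shows "discrete_norm K identity_matrix r = sqrt (\<Sum>\<sigma>\<in>K. (norm (r \<sigma>))\<^sup>2)"
  using assms
  by (simp add: discrete_norm_def identity_matrix_def if_distrib[of "\<lambda>x. x * _"] sum.delta
      power2_norm_eq_inner cong: if_cong)

theorem proposition2p10:
  fixes K :: "'s set"
    and w \<Phi> :: "'s \<Rightarrow> real^'m"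
    and faces :: "'e set"
    and nodes :: "'e \<Rightarrow> (real^'d) set"
    and \<omega> :: "'e \<Rightarrow> real^'d \<Rightarrow> real"
    and \<nu> :: "'e \<Rightarrow> real^'d \<Rightarrow> real^'d"
    and F :: "'d \<Rightarrow> real^'m \<Rightarrow> real^'m \<Rightarrow> real"
    and wh :: "real^'d \<Rightarrow> real^'m"
    and wm :: "'e \<Rightarrow> real^'d \<Rightarrow> real^'m"
    and b E :: real
  assumes "finite K"
    and "finite faces"
    and "\<And>e. e \<in> faces \<Longrightarrow> finite (nodes e)"
    and "b = boundary_flux faces nodes \<omega> \<nu> F wh wm"
    and "E = entropy_error b K w \<Phi>"
    and "\<exists>\<sigma>\<in>K. \<exists>\<tau>\<in>K. w \<sigma> \<noteq> w \<tau>"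
  shows "{r. is_arg_min (\<lambda>r. 1/2 * (\<Sum>\<sigma>\<in>K. (norm (r \<sigma>))\<^sup>2))
              (\<lambda>r. r \<in> K \<rightarrow>\<^sub>E UNIV \<and> (\<Sum>\<sigma>\<in>K. r \<sigma>) = 0 \<and> (\<Sum>\<sigma>\<in>K. w \<sigma> \<bullet> r \<sigma>) = E) r}
          = {correction E K w}
      \<and> {r. is_arg_min (discrete_norm K identity_matrix)
              (\<lambda>r. r \<in> K \<rightarrow>\<^sub>E UNIV \<and> (\<Sum>\<sigma>\<in>K. r \<sigma>) = 0 \<and> (\<Sum>\<sigma>\<in>K. w \<sigma> \<bullet> (\<Phi> \<sigma> + r \<sigma>)) = b) r}
          = {correction E K w}"
proof -
  let ?c = "correction E K w"
  have "K \<noteq> {}" using assms(6) by auto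
  note c = sum_correction[OF assms(1) this] sum_inner_correction[OF assms(1,6)]
  have c_ext: "?c \<in> K \<rightarrow>\<^sub>E UNIV" by (simp add: correction_def)
  \<comment> \<open>By definition \<open>E\<close> is \<open>b\<close> minus the entropy production
    of \<open>\<Phi>\<close>, so both problems have the same feasible set.\<close>
  have constraint: "(\<Sum>\<sigma>\<in>K. w \<sigma> \<bullet> (\<Phi> \<sigma> + r \<sigma>)) = b \<longleftrightarrow> (\<Sum>\<sigma>\<in>K. w \<sigma> \<bullet> r \<sigma>) = E" for r
    using assms(5) by (auto simp: entropy_error_def inner_add_right sum.distrib)
  note less = norm_correction_less[OF assms(1,6)]
  show ?thesis
    unfolding constraint
    by (intro conjI is_arg_min_unique)
      (use c c_ext less in \<open>auto simp: discrete_norm_identity_matrix[OF assms(1)]\<close>)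
qed

end
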